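(* There is an absolute constant $C>0$ such that the following holds for all $\tau>0$ and $\alpha,\beta\in\mathbb R$. If $\alpha\neq0$ and $\beta\ne0$, then $$\big|M_\tau(e^{is(\alpha+\beta)})-M_\tau(e^{is\alpha})M_\tau(e^{is\beta})\big|\le C\min\Big\{\Big|\frac\alpha\beta\Big|,\Big|\frac\beta\alpha\Big|,\tau|\alpha|,\tau|\beta|\Big\}.$$ If $\alpha+\beta\neq0$, then $$\big|M_\tau(e^{is(\alpha+\beta)})-M_\tau(e^{is\alpha})M_\tau(e^{is\beta})\big|\le C\,\tau^{-1}|\alpha+\beta|^{-1}.$$
   Context: For a function $f$ on $[0,\tau]$, $M_\tau(f)=\frac1\tau\int_0^\tau f(s)\,ds$ denotes its average; in $M_\tau(e^{is\alpha})$ the averaged variable is $s\in[0,\tau]$. *)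

theory Defs
  imports "HOL-Analysis.Analysis"
begin

definition avg :: "real \<Rightarrow> (real \<Rightarrow> complex) \<Rightarrow> complex"
  where "avg \<tau> f = complex_of_real (1 / \<tau>) * integral {0..\<tau>} f"

end

theory Submission
  imports Defs
begin

text \<open>
  Write \<open>E(a)\<close> for the mean of \<open>exp (i s a)\<close> over \<open>s\<close> in \<open>[0,\<tau>]\<close>, and \<open>D = E(\<alpha> + \<beta>) - E(\<alpha>) E(\<beta>)\<close>.
  All estimates rest on three properties of \<open>E\<close>: it is bounded by 1, it is Lipschitz with
  constant \<open>\<tau>\<close>, and \<open>i \<tau> a E(a) = exp (i \<tau> a) - 1\<close>, whence \<open>\<tau> |a| |E(a)| \<le> 2\<close>. The last identity is
  used in this product form so that the removable singularity at \<open>a = 0\<close> needs no separate case.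

  The bound by \<open>\<tau> |\<alpha>|\<close> compares both terms of \<open>D\<close> with \<open>E(\<beta>)\<close>, using \<open>E(0) = 1\<close>.
  The bound by \<open>|\<alpha> / \<beta>|\<close> would follow by integrating
  \<open>\<integral> (exp (i s \<alpha>) - E(\<alpha>)) exp (i s \<beta>) ds\<close> by parts: the first factor and its derivative are both small
  when \<open>\<alpha>\<close> is. The algebraic trace of that integration is an expression of \<open>\<beta> D\<close> as \<open>\<alpha>\<close> times
  bounded terms plus \<open>\<beta> E(\<beta>) (1 - E(\<alpha>))\<close>, and no integral is left to estimate.
  As \<open>D\<close> is symmetric, exchanging \<open>\<alpha>\<close> and \<open>\<beta>\<close> completes the minimum. Finally
  \<open>\<tau> (\<alpha> + \<beta>) D\<close> is bounded because each of \<open>\<alpha> + \<beta>\<close>, \<open>\<alpha>\<close> and \<open>\<beta>\<close> can be absorbed into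
  the corresponding mean.
\<close>

definition mean_exp :: "real \<Rightarrow> real \<Rightarrow> complex"
  where "mean_exp \<tau> a = avg \<tau> (\<lambda>s. exp (\<i> * complex_of_real (s * a)))"

definition mean_exp_defect :: "real \<Rightarrow> real \<Rightarrow> real \<Rightarrow> complex"
  where "mean_exp_defect \<tau> \<alpha> \<beta> = mean_exp \<tau> (\<alpha> + \<beta>) - mean_exp \<tau> \<alpha> * mean_exp \<tau> \<beta>"

lemma mean_exp_defect_commute: "mean_exp_defect \<tau> \<alpha> \<beta> = mean_exp_defect \<tau> \<beta> \<alpha>"
  by (simp add: mean_exp_defect_def add.commute mult.commute)

lemma integrable_exp_ii:
  "(\<lambda>s. exp (\<i> * complex_of_real (s * a))) integrable_on {0..\<tau>}"
  by (intro integrable_continuous_interval continuous_intros)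

lemma mean_exp_zero: "\<tau> > 0 \<Longrightarrow> mean_exp \<tau> 0 = 1"
  by (simp add: mean_exp_def avg_def scaleR_conv_of_real)

lemma cmod_mean_exp_le_1:
  assumes "\<tau> > 0"
  shows "cmod (mean_exp \<tau> a) \<le> 1"
proof -
  have "cmod (integral {0..\<tau>} (\<lambda>s. exp (\<i> * complex_of_real (s * a)))) \<le> 1 * (\<tau> - 0)"
    using assms by (intro integral_bound) (auto intro!: continuous_intros)
  then show ?thesis
    using assms by (simp add: mean_exp_def avg_def norm_mult norm_divide field_simps)
qed

lemma cmod_exp_ii_diff_le:
  fixes x y :: real
  shows "cmod (exp (\<i> * complex_of_real x) - exp (\<i> * complex_of_real y)) \<le> \<bar>x - y\<bar>"
proof -
  have "exp (\<i> * complex_of_real x) - exp (\<i> * complex_of_real y)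
      = exp (\<i> * complex_of_real y) * (exp (\<i> * complex_of_real (x - y)) - 1)"
    by (simp add: algebra_simps flip: exp_add)
  moreover have "cmod (exp (\<i> * complex_of_real (x - y)) - 1) \<le> \<bar>x - y\<bar>"
    unfolding dist_exp_i_1 using abs_sin_x_le_abs_x[of "(x - y) / 2"] by simp
  ultimately show ?thesis
    by (simp add: norm_mult)
qed

lemma mean_exp_lipschitz:
  assumes "\<tau> > 0"
  shows "cmod (mean_exp \<tau> a - mean_exp \<tau> b) \<le> \<tau> * \<bar>a - b\<bar>"
proof -
  let ?f = "\<lambda>s. exp (\<i> * complex_of_real (s * a)) - exp (\<i> * complex_of_real (s * b))"
  have "cmod (?f s) \<le> \<tau> * \<bar>a - b\<bar>" if "s \<in> {0..\<tau>}" for s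
  proof -
    have "cmod (?f s) \<le> s * \<bar>a - b\<bar>"
      using cmod_exp_ii_diff_le[of "s * a" "s * b"] that
      by (simp add: abs_mult flip: right_diff_distrib)
    also have "\<dots> \<le> \<tau> * \<bar>a - b\<bar>"
      using that by (intro mult_right_mono) auto
    finally show ?thesis .
  qed
  then have "cmod (integral {0..\<tau>} ?f) \<le> (\<tau> * \<bar>a - b\<bar>) * (\<tau> - 0)"
    using assms by (intro integral_bound continuous_intros) auto
  moreover have "mean_exp \<tau> a - mean_exp \<tau> b = complex_of_real (1 / \<tau>) * integral {0..\<tau>} ?f"
    unfolding mean_exp_def avg_def
    by (simp only: integral_diff[OF integrable_exp_ii integrable_exp_ii] right_diff_distrib)
  ultimately show ?thesis
    using assms by (simp only: norm_mult norm_of_real) (simp add: field_simps)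
qed

lemma freq_times_mean_exp:
  assumes "\<tau> > 0"
  shows "\<i> * complex_of_real (\<tau> * a) * mean_exp \<tau> a = exp (\<i> * complex_of_real (\<tau> * a)) - 1"
proof -
  let ?e = "\<lambda>s. exp (\<i> * complex_of_real (s * a))"
  have "((\<lambda>s. \<i> * complex_of_real a * ?e s) has_integral (?e \<tau> - ?e 0)) {0..\<tau>}"
  proof (rule fundamental_theorem_of_calculus)
    show "(?e has_vector_derivative (\<i> * complex_of_real a * ?e s)) (at s within {0..\<tau>})" for s
      by (auto intro!: derivative_eq_intros
          has_vector_derivative_real_field[where f = "\<lambda>z. exp (\<i> * (z * complex_of_real a))"])
  qed (use assms in simp)
  then have "\<i> * complex_of_real a * integral {0..\<tau>} ?e = ?e \<tau> - 1"
    by (simp add: integral_unique flip: integral_mult_right)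
  then show ?thesis
    using assms by (simp add: mean_exp_def avg_def mult.assoc)
qed

lemma abs_freq_times_mean_exp_le_2:
  assumes "\<tau> > 0"
  shows "\<tau> * \<bar>a\<bar> * cmod (mean_exp \<tau> a) \<le> 2"
proof -
  have "\<tau> * \<bar>a\<bar> * cmod (mean_exp \<tau> a) = cmod (exp (\<i> * complex_of_real (\<tau> * a)) - 1)"
    unfolding freq_times_mean_exp[OF assms, symmetric]
    using assms by (simp add: norm_mult abs_mult)
  also have "\<dots> \<le> cmod (exp (\<i> * complex_of_real (\<tau> * a))) + cmod 1"
    by (rule norm_triangle_ineq4)
  finally show ?thesis by simp
qed

lemma mean_exp_defect_le_freq:
  assumes "\<tau> > 0"
  shows "cmod (mean_exp_defect \<tau> \<alpha> \<beta>) \<le> 2 * (\<tau> * \<bar>\<alpha>\<bar>)"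
proof -
  let ?E = "mean_exp \<tau>"
  have split: "mean_exp_defect \<tau> \<alpha> \<beta> = (?E (\<alpha> + \<beta>) - ?E \<beta>) - (?E \<alpha> - ?E 0) * ?E \<beta>"
    using assms by (simp add: mean_exp_defect_def mean_exp_zero algebra_simps)
  have "cmod ((?E \<alpha> - ?E 0) * ?E \<beta>) \<le> (\<tau> * \<bar>\<alpha>\<bar>) * 1"
    unfolding norm_mult using assms mean_exp_lipschitz[of \<tau> \<alpha> 0]
    by (intro mult_mono cmod_mean_exp_le_1) auto
  moreover have "cmod (?E (\<alpha> + \<beta>) - ?E \<beta>) \<le> \<tau> * \<bar>\<alpha>\<bar>"
    using mean_exp_lipschitz[OF assms, of "\<alpha> + \<beta>" \<beta>] by simp
  ultimately show ?thesis
    unfolding split by (intro norm_triangle_ineq4[THEN order_trans]) simp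
qed

text \<open>
  With \<open>e(a) = exp (i \<tau> a)\<close>, expanding \<open>e(\<alpha> + \<beta>) - 1 = (e(\<alpha>) - 1) e(\<beta>) + (e(\<beta>) - 1)\<close> gives
  \<open>(\<alpha> + \<beta>) E(\<alpha> + \<beta>) = \<alpha> E(\<alpha>) e(\<beta>) + \<beta> E(\<beta>)\<close>. Solving for \<open>\<beta> E(\<alpha> + \<beta>)\<close> exhibits the factor
  \<open>\<alpha>\<close> in every term of \<open>\<beta> D\<close> except \<open>\<beta> E(\<beta>) (1 - E(\<alpha>))\<close>, where it comes from the Lipschitz bound.
\<close>
lemma mean_exp_defect_le_ratio:
  assumes "\<tau> > 0"
  shows "\<bar>\<beta>\<bar> * cmod (mean_exp_defect \<tau> \<alpha> \<beta>) \<le> 4 * \<bar>\<alpha>\<bar>"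
proof -
  let ?E = "mean_exp \<tau>"
  let ?e = "\<lambda>a. exp (\<i> * complex_of_real (\<tau> * a))"
  let ?t = "complex_of_real \<tau>" and ?a = "complex_of_real \<alpha>" and ?b = "complex_of_real \<beta>"
  have addition: "(?a + ?b) * ?E (\<alpha> + \<beta>) = ?a * ?E \<alpha> * ?e \<beta> + ?b * ?E \<beta>"
  proof -
    have "\<i> * ?t * ((?a + ?b) * ?E (\<alpha> + \<beta>)) = ?e (\<alpha> + \<beta>) - 1"
      using freq_times_mean_exp[OF assms, of "\<alpha> + \<beta>"] by (simp add: algebra_simps)
    also have "\<dots> = (?e \<alpha> - 1) * ?e \<beta> + (?e \<beta> - 1)"
      by (simp add: algebra_simps exp_add)
    also have "\<dots> = \<i> * ?t * (?a * ?E \<alpha> * ?e \<beta> + ?b * ?E \<beta>)"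
      unfolding freq_times_mean_exp[OF assms, symmetric] by (simp add: algebra_simps)
    finally show ?thesis
      using assms by simp
  qed
  have split: "?b * mean_exp_defect \<tau> \<alpha> \<beta>
      = ?a * (?E \<alpha> * ?e \<beta> - ?E (\<alpha> + \<beta>)) + (?b * ?E \<beta>) * (?E 0 - ?E \<alpha>)"
    using addition assms unfolding mean_exp_defect_def by (simp add: mean_exp_zero algebra_simps)
  have "cmod (?E \<alpha> * ?e \<beta> - ?E (\<alpha> + \<beta>)) \<le> cmod (?E \<alpha> * ?e \<beta>) + cmod (?E (\<alpha> + \<beta>))"
    by (rule norm_triangle_ineq4)
  also have "\<dots> \<le> 2"
    using cmod_mean_exp_le_1[OF assms, of \<alpha>] cmod_mean_exp_le_1[OF assms, of "\<alpha> + \<beta>"]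
    by (simp add: norm_mult)
  finally have "cmod (?a * (?E \<alpha> * ?e \<beta> - ?E (\<alpha> + \<beta>))) \<le> \<bar>\<alpha>\<bar> * 2"
    unfolding norm_mult norm_of_real by (intro mult_left_mono) auto
  moreover have "cmod ((?b * ?E \<beta>) * (?E 0 - ?E \<alpha>)) \<le> 2 * \<bar>\<alpha>\<bar>"
  proof -
    have "cmod ((?b * ?E \<beta>) * (?E 0 - ?E \<alpha>)) \<le> (\<bar>\<beta>\<bar> * cmod (?E \<beta>)) * (\<tau> * \<bar>\<alpha>\<bar>)"
      unfolding norm_mult norm_of_real
      using mean_exp_lipschitz[OF assms, of 0 \<alpha>] by (intro mult_left_mono) auto
    also have "\<dots> = (\<tau> * \<bar>\<beta>\<bar> * cmod (?E \<beta>)) * \<bar>\<alpha>\<bar>"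
      by simp
    also have "\<dots> \<le> 2 * \<bar>\<alpha>\<bar>"
      by (intro mult_right_mono abs_freq_times_mean_exp_le_2 assms) simp
    finally show ?thesis .
  qed
  ultimately have "cmod (?b * mean_exp_defect \<tau> \<alpha> \<beta>) \<le> 4 * \<bar>\<alpha>\<bar>"
    unfolding split by (intro norm_triangle_ineq[THEN order_trans]) simp
  then show ?thesis
    by (simp add: norm_mult)
qed

text \<open>
  The constant is \<open>6 = 2 + 4\<close>: \<open>E(\<alpha> + \<beta>)\<close> costs 2, and the product costs 2 for each summand of
  \<open>|\<alpha> + \<beta>| \<le> |\<alpha>| + |\<beta>|\<close>, one mean absorbing the frequency while the other is bounded by 1.
\<close>
lemma mean_exp_defect_le_inverse_sum:
  assumes "\<tau> > 0"
  shows "\<tau> * \<bar>\<alpha> + \<beta>\<bar> * cmod (mean_exp_defect \<tau> \<alpha> \<beta>) \<le> 6"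
proof -
  let ?n = "\<lambda>a. cmod (mean_exp \<tau> a)"
  have absorb: "\<tau> * \<bar>a\<bar> * (?n a * ?n b) \<le> 2" for a b
  proof -
    have "(\<tau> * \<bar>a\<bar> * ?n a) * ?n b \<le> 2 * 1"
      using assms by (intro mult_mono abs_freq_times_mean_exp_le_2 cmod_mean_exp_le_1) auto
    then show ?thesis by (simp add: mult.assoc)
  qed
  have "\<tau> * \<bar>\<alpha> + \<beta>\<bar> * (?n \<alpha> * ?n \<beta>) \<le> \<tau> * (\<bar>\<alpha>\<bar> + \<bar>\<beta>\<bar>) * (?n \<alpha> * ?n \<beta>)"
    using assms by (intro mult_right_mono mult_left_mono) auto
  also have "\<dots> = \<tau> * \<bar>\<alpha>\<bar> * (?n \<alpha> * ?n \<beta>) + \<tau> * \<bar>\<beta>\<bar> * (?n \<beta> * ?n \<alpha>)"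
    by (simp add: algebra_simps)
  also have "\<dots> \<le> 4"
    using absorb[of \<alpha> \<beta>] absorb[of \<beta> \<alpha>] by simp
  finally have prod: "\<tau> * \<bar>\<alpha> + \<beta>\<bar> * (?n \<alpha> * ?n \<beta>) \<le> 4" .
  have "cmod (mean_exp_defect \<tau> \<alpha> \<beta>) \<le> ?n (\<alpha> + \<beta>) + ?n \<alpha> * ?n \<beta>"
    unfolding mean_exp_defect_def norm_mult[symmetric] by (rule norm_triangle_ineq4)
  then have "\<tau> * \<bar>\<alpha> + \<beta>\<bar> * cmod (mean_exp_defect \<tau> \<alpha> \<beta>)
      \<le> \<tau> * \<bar>\<alpha> + \<beta>\<bar> * (?n (\<alpha> + \<beta>) + ?n \<alpha> * ?n \<beta>)"
    using assms by (intro mult_left_mono) auto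
  also have "\<dots> \<le> 6"
    using prod abs_freq_times_mean_exp_le_2[OF assms, of "\<alpha> + \<beta>"] by (simp add: distrib_left)
  finally show ?thesis .
qed

theorem lemma3p2:
  "\<exists>C::real. C > 0 \<and> (\<forall>\<tau> \<alpha> \<beta> :: real. \<tau> > 0 \<longrightarrow>
     (\<alpha> \<noteq> 0 \<and> \<beta> \<noteq> 0 \<longrightarrow>
        cmod (avg \<tau> (\<lambda>s. exp (\<i> * complex_of_real (s * (\<alpha> + \<beta>))))
              - avg \<tau> (\<lambda>s. exp (\<i> * complex_of_real (s * \<alpha>)))
                * avg \<tau> (\<lambda>s. exp (\<i> * complex_of_real (s * \<beta>))))
        \<le> C * Min {\<bar>\<alpha> / \<beta>\<bar>, \<bar>\<beta> / \<alpha>\<bar>, \<tau> * \<bar>\<alpha>\<bar>, \<tau> * \<bar>\<beta>\<bar>}) \<and>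
     (\<alpha> + \<beta> \<noteq> 0 \<longrightarrow>
        cmod (avg \<tau> (\<lambda>s. exp (\<i> * complex_of_real (s * (\<alpha> + \<beta>))))
              - avg \<tau> (\<lambda>s. exp (\<i> * complex_of_real (s * \<alpha>)))
                * avg \<tau> (\<lambda>s. exp (\<i> * complex_of_real (s * \<beta>))))
        \<le> C * inverse \<tau> * inverse \<bar>\<alpha> + \<beta>\<bar>))"
proof -
  have minimum: "cmod (mean_exp_defect \<tau> \<alpha> \<beta>)
      \<le> 6 * Min {\<bar>\<alpha> / \<beta>\<bar>, \<bar>\<beta> / \<alpha>\<bar>, \<tau> * \<bar>\<alpha>\<bar>, \<tau> * \<bar>\<beta>\<bar>}"
    if "\<tau> > 0" "\<alpha> \<noteq> 0" "\<beta> \<noteq> 0" for \<tau> \<alpha> \<beta> :: real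
  proof -
    let ?d = "cmod (mean_exp_defect \<tau> \<alpha> \<beta>)"
    have freq: "?d \<le> 6 * (\<tau> * \<bar>\<alpha>\<bar>)" "?d \<le> 6 * (\<tau> * \<bar>\<beta>\<bar>)"
      using mean_exp_defect_le_freq[OF \<open>\<tau> > 0\<close>, of \<alpha> \<beta>]
        mean_exp_defect_le_freq[OF \<open>\<tau> > 0\<close>, of \<beta> \<alpha>] \<open>\<tau> > 0\<close>
        mult_nonneg_nonneg[of \<tau> "\<bar>\<alpha>\<bar>"] mult_nonneg_nonneg[of \<tau> "\<bar>\<beta>\<bar>"]
      unfolding mean_exp_defect_commute[of \<tau> \<beta> \<alpha>] by linarith+
    have ratio: "\<bar>\<beta>\<bar> * ?d \<le> 6 * \<bar>\<alpha>\<bar>" "\<bar>\<alpha>\<bar> * ?d \<le> 6 * \<bar>\<beta>\<bar>"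
      using mean_exp_defect_le_ratio[OF \<open>\<tau> > 0\<close>, of \<beta> \<alpha>]
        mean_exp_defect_le_ratio[OF \<open>\<tau> > 0\<close>, of \<alpha> \<beta>]
      unfolding mean_exp_defect_commute[of \<tau> \<beta> \<alpha>] by linarith+
    have "?d / 6 \<le> Min {\<bar>\<alpha> / \<beta>\<bar>, \<bar>\<beta> / \<alpha>\<bar>, \<tau> * \<bar>\<alpha>\<bar>, \<tau> * \<bar>\<beta>\<bar>}"
      using that freq ratio by (simp add: abs_divide field_simps)
    then show ?thesis by linarith
  qed
  have inverse_sum: "cmod (mean_exp_defect \<tau> \<alpha> \<beta>) \<le> 6 * inverse \<tau> * inverse \<bar>\<alpha> + \<beta>\<bar>"
    if "\<tau> > 0" "\<alpha> + \<beta> \<noteq> 0" for \<tau> \<alpha> \<beta> :: real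
    using mean_exp_defect_le_inverse_sum[OF \<open>\<tau> > 0\<close>, of \<alpha> \<beta>] that
    by (simp add: field_simps)
  show ?thesis
    using minimum inverse_sum unfolding mean_exp_defect_def mean_exp_def
    by (intro exI[of _ "6::real"] conjI[OF zero_less_numeral]) blast
qed

end
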